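(* Let $H$ be a monoid, and let $p$ be a prime element of $H$. The following hold: (i) If $p\mid_H x_1\cdots x_n$ for some integer $n \ge 1$ and $x_1,\dots,x_n\in H$, then $p\mid_H x_i$ for some $i\in\{1,\dots,n\}$. (ii) If $H$ is acyclic or atomic, then $p$ is an atom of $H$.
   Context: Let $H$ be a multiplicatively written monoid (not necessarily commutative or cancellative) with group of units $H^\times$. For $x,y\in H$, $x\mid_H y$ means $y=uxv$ for some $u,v\in H$. An element $p\in H$ is prime if $p\notin H^\times$ and, whenever $p\mid_H xy$ for some $x,y\in H$, then $p\mid_H x$ or $p\mid_H y$. An atom of $H$ is an element $a \in H \setminus H^\times$ such that $a \ne xy$ for all $x,y \in H\setminus H^\times$. $H$ is atomic if every element of $H\setminus H^\times$ is a finite product of atoms. $H$ is acyclic if $x\ne uxv$ for all $u,v,x\in H$ with $u\notin H^\times$ or $v\notin H^\times$. *)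

theory Defs
  imports "HOL-Algebra.Group"
begin

text \<open>
  The divisibility relation, primes and irreducibles of \<open>HOL-Algebra.Divisibility\<close> are based on
  one-sided divisibility (\<open>b = a \<otimes> c\<close>); the two-sided versions needed for
  arbitrary monoids are introduced here.
\<close>

definition two_sided_dvd :: "('a, 'b) monoid_scheme \<Rightarrow> 'a \<Rightarrow> 'a \<Rightarrow> bool"
  where "two_sided_dvd H x y \<longleftrightarrow>
    (\<exists>u\<in>carrier H. \<exists>v\<in>carrier H. y = u \<otimes>\<^bsub>H\<^esub> x \<otimes>\<^bsub>H\<^esub> v)"

definition prime_element :: "('a, 'b) monoid_scheme \<Rightarrow> 'a \<Rightarrow> bool"
  where "prime_element H p \<longleftrightarrow>
    p \<in> carrier H - Units H \<and>
    (\<forall>x\<in>carrier H. \<forall>y\<in>carrier H.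
       two_sided_dvd H p (x \<otimes>\<^bsub>H\<^esub> y) \<longrightarrow> two_sided_dvd H p x \<or> two_sided_dvd H p y)"

definition monoid_atom :: "('a, 'b) monoid_scheme \<Rightarrow> 'a \<Rightarrow> bool"
  where "monoid_atom H a \<longleftrightarrow>
    a \<in> carrier H - Units H \<and>
    (\<forall>x\<in>carrier H - Units H. \<forall>y\<in>carrier H - Units H. a \<noteq> x \<otimes>\<^bsub>H\<^esub> y)"

definition list_product :: "('a, 'b) monoid_scheme \<Rightarrow> 'a list \<Rightarrow> 'a"
  where "list_product H xs = foldr (\<otimes>\<^bsub>H\<^esub>) xs \<one>\<^bsub>H\<^esub>"

text \<open>
  Allowing the empty list below is harmless: its product is the identity, which is a unit.
\<close>

definition atomic_monoid :: "('a, 'b) monoid_scheme \<Rightarrow> bool"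
  where "atomic_monoid H \<longleftrightarrow>
    (\<forall>x\<in>carrier H - Units H. \<exists>as. (\<forall>a\<in>set as. monoid_atom H a) \<and> x = list_product H as)"

definition acyclic_monoid :: "('a, 'b) monoid_scheme \<Rightarrow> bool"
  where "acyclic_monoid H \<longleftrightarrow>
    (\<forall>u\<in>carrier H. \<forall>v\<in>carrier H. \<forall>x\<in>carrier H.
       u \<notin> Units H \<or> v \<notin> Units H \<longrightarrow> x \<noteq> u \<otimes>\<^bsub>H\<^esub> x \<otimes>\<^bsub>H\<^esub> v)"

end

theory Submission
  imports Defs
begin

text \<open>
  The first part is an induction on the number of factors, peeling off the leftmost factor.

  For the second part, the obstacle is that in a general monoid a factor of a unit need not be a
  unit, because an element may have an inverse on one side only. Both hypotheses exclude this:
  they make the monoid Dedekind-finite, i.e. \<open>a \<otimes> b = \<one>\<close> forces \<open>a\<close> and \<open>b\<close> to be units. For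
  acyclic monoids this is read off from \<open>\<one> = a \<otimes> \<one> \<otimes> b\<close>. For atomic monoids, the point is that an
  atom \<open>a\<close> cannot have a right inverse \<open>b\<close>: otherwise \<open>a = a \<otimes> (b \<otimes> a)\<close> would be a product of two
  non-units (lemma \<open>atom_no_right_inverse\<close>); and the first atomic factor of a right-invertible
  non-unit would be such an atom.

  Now let \<open>p\<close> be prime. In the acyclic case, write \<open>p = x \<otimes> y\<close> with non-units \<open>x\<close>, \<open>y\<close>; then \<open>p\<close> divides
  one of them, say \<open>x = u \<otimes> p \<otimes> v\<close>, and \<open>p = u \<otimes> p \<otimes> (v \<otimes> y)\<close> is a cycle, as \<open>v \<otimes> y\<close> is not a unit.
  In the atomic case, write \<open>p\<close> as a product of atoms; by the first part \<open>p\<close> divides one of these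
  atoms, and a non-unit dividing an atom is itself an atom (lemma \<open>nonunit_dvd_atom\<close>).
\<close>

definition dedekind_finite :: "('a, 'b) monoid_scheme \<Rightarrow> bool"
  where "dedekind_finite H \<longleftrightarrow>
    (\<forall>a\<in>carrier H. \<forall>b\<in>carrier H. a \<otimes>\<^bsub>H\<^esub> b = \<one>\<^bsub>H\<^esub> \<longrightarrow> a \<in> Units H)"

lemma (in monoid) list_product_closed:
  "set xs \<subseteq> carrier G \<Longrightarrow> list_product G xs \<in> carrier G"
  by (induction xs) (auto simp: list_product_def)

lemma (in monoid) two_sided_dvd_refl:
  assumes "x \<in> carrier G"
  shows "two_sided_dvd G x x"
proof -
  have "x = \<one> \<otimes> x \<otimes> \<one>" using assms by simp
  then show ?thesis unfolding two_sided_dvd_def by blast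
qed

text \<open>
  The base case of the induction has to be a single factor: for the empty product one would need
  that a prime does not divide \<open>\<one>\<close>, which can fail in a general monoid.
\<close>

lemma (in monoid) prime_dvd_list_product:
  assumes "prime_element G p" and "xs \<noteq> []" and "set xs \<subseteq> carrier G"
    and "two_sided_dvd G p (list_product G xs)"
  shows "\<exists>x\<in>set xs. two_sided_dvd G p x"
  using assms(2-)
proof (induction xs rule: list_nonempty_induct)
  case (single x)
  then show ?case by (simp add: list_product_def)
next
  case (cons x xs)
  have "two_sided_dvd G p (x \<otimes> list_product G xs)"
    using cons.prems by (simp add: list_product_def)
  then have "two_sided_dvd G p x \<or> two_sided_dvd G p (list_product G xs)"
    using assms(1) list_product_closed cons.prems by (simp add: prime_element_def)
  then show ?case using cons by auto
qed

text \<open>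
  The inverse of \<open>x \<otimes> y\<close>, multiplied by the other factor, is a right inverse of \<open>x\<close> and a left inverse
  of \<open>y\<close>. Dedekind-finiteness applies to the left factor of a product equal to \<open>\<one>\<close>; for \<open>y\<close> it shows
  first that the left inverse is a unit, whose inverse is then \<open>y\<close>.
\<close>

lemma (in monoid) dedekind_finite_factors_Units:
  assumes df: "dedekind_finite G" and x: "x \<in> carrier G" and y: "y \<in> carrier G"
    and xy: "x \<otimes> y \<in> Units G"
  shows "x \<in> Units G" and "y \<in> Units G"
proof -
  let ?w = "inv (x \<otimes> y)"
  have w: "?w \<in> carrier G" using xy by simp
  have "x \<otimes> (y \<otimes> ?w) = \<one>"
    using Units_r_inv[OF xy] x y w by (simp add: m_assoc)
  then show "x \<in> Units G"
    using df x y w unfolding dedekind_finite_def by blast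
  have eq: "(?w \<otimes> x) \<otimes> y = \<one>"
    using Units_l_inv[OF xy] x y w by (simp add: m_assoc)
  then have wx: "?w \<otimes> x \<in> Units G"
    using df x y w unfolding dedekind_finite_def by blast
  have "y = inv (?w \<otimes> x)"
    using wx eq y by (metis Units_closed Units_inv_closed Units_l_inv inv_unique)
  then show "y \<in> Units G" using wx by (metis Units_inv_Units)
qed

lemma (in monoid) acyclic_imp_dedekind_finite:
  assumes "acyclic_monoid G"
  shows "dedekind_finite G"
  unfolding dedekind_finite_def
proof (intro ballI impI)
  fix a b assume a: "a \<in> carrier G" and b: "b \<in> carrier G" and "a \<otimes> b = \<one>"
  then have "\<one> = a \<otimes> \<one> \<otimes> b" by simp
  then show "a \<in> Units G"
    using assms a b unfolding acyclic_monoid_def by blast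
qed

text \<open>
  If \<open>a \<otimes> b = \<one>\<close>, then \<open>b \<otimes> a\<close> is idempotent. Were it a unit, it would equal \<open>\<one>\<close> and \<open>a\<close> would be
  a unit; so \<open>a = a \<otimes> (b \<otimes> a)\<close> splits \<open>a\<close> into two non-units.
\<close>

lemma (in monoid) atom_no_right_inverse:
  assumes atom: "monoid_atom G a" and b: "b \<in> carrier G"
  shows "a \<otimes> b \<noteq> \<one>"
proof
  assume ab: "a \<otimes> b = \<one>"
  have a: "a \<in> carrier G" "a \<notin> Units G"
    using atom by (auto simp: monoid_atom_def)
  have split: "a = a \<otimes> (b \<otimes> a)"
    using a b ab by (simp add: m_assoc[symmetric])
  have "b \<otimes> a \<in> Units G"
    using atom a b split by (auto simp: monoid_atom_def)
  moreover have "(b \<otimes> a) \<otimes> (b \<otimes> a) = (b \<otimes> a) \<otimes> \<one>"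
    using a b split by (simp add: m_assoc)
  ultimately have "b \<otimes> a = \<one>"
    using Units_l_cancel[of "b \<otimes> a" "b \<otimes> a" \<one>] a b by simp
  then show False
    using a b ab by (auto simp: Units_def)
qed

lemma (in monoid) atomic_imp_dedekind_finite:
  assumes "atomic_monoid G"
  shows "dedekind_finite G"
  unfolding dedekind_finite_def
proof (intro ballI impI, rule ccontr)
  fix a b assume a: "a \<in> carrier G" and b: "b \<in> carrier G" and ab: "a \<otimes> b = \<one>"
    and nonunit: "a \<notin> Units G"
  obtain as where atoms: "\<forall>q\<in>set as. monoid_atom G q" and prod: "a = list_product G as"
    using assms a nonunit unfolding atomic_monoid_def by blast
  have "as \<noteq> []"
    using prod nonunit by (auto simp: list_product_def)
  then obtain q qs where as: "as = q # qs" by (cases as) auto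
  have q: "monoid_atom G q" "q \<in> carrier G" and qs: "list_product G qs \<in> carrier G"
    using atoms as by (auto intro!: list_product_closed simp: monoid_atom_def)
  have "q \<otimes> (list_product G qs \<otimes> b) = \<one>"
    using ab prod as q qs b by (simp add: list_product_def m_assoc)
  then show False
    using atom_no_right_inverse q qs b by blast
qed

text \<open>
  Any factorization \<open>p = x \<otimes> y\<close> turns \<open>a = u \<otimes> p \<otimes> v\<close> into the factorization
  \<open>a = (u \<otimes> x) \<otimes> (y \<otimes> v)\<close> of the atom. One of these two factors is a unit, and hence so is
  \<open>x\<close> or \<open>y\<close>.
\<close>

lemma (in monoid) nonunit_dvd_atom:
  assumes df: "dedekind_finite G" and p: "p \<in> carrier G - Units G"
    and atom: "monoid_atom G a" and dvd: "two_sided_dvd G p a"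
  shows "monoid_atom G p"
  unfolding monoid_atom_def
proof (intro conjI ballI notI)
  show "p \<in> carrier G - Units G" by (fact p)
  fix x y assume x: "x \<in> carrier G - Units G" and y: "y \<in> carrier G - Units G"
    and eq: "p = x \<otimes> y"
  obtain u v where uv: "u \<in> carrier G" "v \<in> carrier G" and a: "a = u \<otimes> p \<otimes> v"
    using dvd unfolding two_sided_dvd_def by blast
  have "a = (u \<otimes> x) \<otimes> (y \<otimes> v)"
    using a eq uv x y by (simp add: m_assoc)
  then have "u \<otimes> x \<in> Units G \<or> y \<otimes> v \<in> Units G"
    using atom uv x y unfolding monoid_atom_def by auto
  then show False
    using dedekind_finite_factors_Units[OF df] uv x y by blast
qed

lemma (in monoid) prime_atom_if_atomic:
  assumes atomic: "atomic_monoid G" and prime: "prime_element G p"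
  shows "monoid_atom G p"
proof -
  have p: "p \<in> carrier G - Units G"
    using prime by (simp add: prime_element_def)
  then obtain as where atoms: "\<forall>a\<in>set as. monoid_atom G a" and prod: "p = list_product G as"
    using atomic unfolding atomic_monoid_def by blast
  have "as \<noteq> []"
    using prod p by (auto simp: list_product_def)
  moreover have "set as \<subseteq> carrier G"
    using atoms by (auto simp: monoid_atom_def)
  moreover have "two_sided_dvd G p (list_product G as)"
    using two_sided_dvd_refl p prod by auto
  ultimately obtain a where "a \<in> set as" "two_sided_dvd G p a"
    using prime_dvd_list_product[OF prime] by blast
  then show ?thesis
    using nonunit_dvd_atom[OF atomic_imp_dedekind_finite[OF atomic] p] atoms by blast
qed

lemma (in monoid) prime_atom_if_acyclic:
  assumes acyclic: "acyclic_monoid G" and prime: "prime_element G p"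
  shows "monoid_atom G p"
  unfolding monoid_atom_def
proof (intro conjI ballI notI)
  show p: "p \<in> carrier G - Units G"
    using prime by (simp add: prime_element_def)
  note factors = dedekind_finite_factors_Units[OF acyclic_imp_dedekind_finite[OF acyclic]]
  fix x y assume x: "x \<in> carrier G - Units G" and y: "y \<in> carrier G - Units G"
    and eq: "p = x \<otimes> y"
  have "two_sided_dvd G p (x \<otimes> y)"
    using two_sided_dvd_refl[of p] p eq by simp
  then consider "two_sided_dvd G p x" | "two_sided_dvd G p y"
    using prime x y unfolding prime_element_def by blast
  then show False
  proof cases
    case 1
    then obtain u v where uv: "u \<in> carrier G" "v \<in> carrier G" and "x = u \<otimes> p \<otimes> v"
      unfolding two_sided_dvd_def by blast
    then have "p = u \<otimes> p \<otimes> (v \<otimes> y)"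
      using eq uv p y by (metis DiffD1 m_assoc m_closed)
    moreover have "v \<otimes> y \<notin> Units G"
      using factors uv y by blast
    ultimately show False
      using acyclic uv p y unfolding acyclic_monoid_def by blast
  next
    case 2
    then obtain u v where uv: "u \<in> carrier G" "v \<in> carrier G" and "y = u \<otimes> p \<otimes> v"
      unfolding two_sided_dvd_def by blast
    then have "p = (x \<otimes> u) \<otimes> p \<otimes> v"
      using eq uv p x by (metis DiffD1 m_assoc m_closed)
    moreover have "x \<otimes> u \<notin> Units G"
      using factors uv x by blast
    ultimately show False
      using acyclic uv p x unfolding acyclic_monoid_def by blast
  qed
qed

theorem proposition5p3:
  fixes H :: "('a, 'b) monoid_scheme" and p :: 'a
  assumes "monoid H" and "prime_element H p"
  shows "(\<forall>xs. length xs \<ge> 1 \<and> set xs \<subseteq> carrier H \<and> two_sided_dvd H p (list_product H xs)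
            \<longrightarrow> (\<exists>i<length xs. two_sided_dvd H p (xs ! i)))
       \<and> (acyclic_monoid H \<or> atomic_monoid H \<longrightarrow> monoid_atom H p)"
proof (intro conjI allI impI)
  interpret monoid H by (fact assms(1))
  {
    fix xs
    assume xs: "length xs \<ge> 1 \<and> set xs \<subseteq> carrier H \<and> two_sided_dvd H p (list_product H xs)"
    then have "xs \<noteq> []" by auto
    then obtain x where "x \<in> set xs" "two_sided_dvd H p x"
      using prime_dvd_list_product[OF assms(2)] xs by blast
    then show "\<exists>i<length xs. two_sided_dvd H p (xs ! i)"
      by (metis in_set_conv_nth)
  next
    assume "acyclic_monoid H \<or> atomic_monoid H"
    then show "monoid_atom H p"
      using prime_atom_if_acyclic prime_atom_if_atomic assms(2) by blast
  }
qed

end
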